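(* Let $S\subseteq\mathbb{H}$ be open and let $f:S\to\mathbb{H}$ be continuous, such that its left HR derivatives up to order three exist and are continuous in $S$. If $q_0,q_0+\lambda\in S$ are such that the segment joining them is also in $S$, then, as $\lambda\to0$, $$f(q_0+\lambda)-f(q_0)=\sum_{\mu}\frac{\partial f(q_0)}{\partial q^{\mu}}\lambda^{\mu}+\frac12\sum_{\mu,\nu}\frac{\partial^2 f(q_0)}{\partial q^{\nu}\partial q^{\mu}}\lambda^{\nu}\lambda^{\mu}+O(|\lambda|^3)$$ $$=\sum_{\mu}\frac{\partial f(q_0)}{\partial q^{\mu*}}\lambda^{\mu*}+\frac12\sum_{\mu,\nu}\frac{\partial^2 f(q_0)}{\partial q^{\nu*}\partial q^{\mu*}}\lambda^{\nu*}\lambda^{\mu*}+O(|\lambda|^3),$$ where the sums run over $\mu,\nu\in\{1,i,j,k\}$.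
   Context: $\mathbb{H}$ denotes the real quaternions $q=q_a+iq_b+jq_c+kq_d$ with $q_a,q_b,q_c,q_d\in\mathbb{R}$ and $i^2=j^2=k^2=ijk=-1$. The conjugate is $q^*=q_a-iq_b-jq_c-kq_d$, and $|q|=\sqrt{qq^*}$. For $\mu\in\{1,i,j,k\}$ and $p\in\mathbb{H}$, $p^{\mu}:=\mu p\mu^{-1}$ and $p^{\mu*}:=(p^{\mu})^*$. An $\mathbb{H}$-valued function $f$ is regarded as a function of the four real variables $q_a,q_b,q_c,q_d$, with ($\mathbb{H}$-valued, componentwise) partial derivatives $\frac{\partial f}{\partial q_a},\dots,\frac{\partial f}{\partial q_d}$. The left HR derivatives of $f$ are, for $\mu\in\{1,i,j,k\}$, $$\frac{\partial f}{\partial q^{\mu}}=\frac14\left(\frac{\partial f}{\partial q_a}-\frac{\partial f}{\partial q_b}i^{\mu}-\frac{\partial f}{\partial q_c}j^{\mu}-\frac{\partial f}{\partial q_d}k^{\mu}\right),\qquad \frac{\partial f}{\partial q^{\mu*}}=\frac14\left(\frac{\partial f}{\partial q_a}+\frac{\partial f}{\partial q_b}i^{\mu}+\frac{\partial f}{\partial q_c}j^{\mu}+\frac{\partial f}{\partial q_d}k^{\mu}\right).$$ Higher-order left HR derivatives are iterated ones: $\frac{\partial^2 f}{\partial q^{\nu}\partial q^{\mu}}=\frac{\partial}{\partial q^{\nu}}\left(\frac{\partial f}{\partial q^{\mu}}\right)$, $\frac{\partial^2 f}{\partial q^{\nu*}\partial q^{\mu*}}=\frac{\partial}{\partial q^{\nu*}}\left(\frac{\partial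 f}{\partial q^{\mu*}}\right)$, and similarly for mixed choices and for third order. *)

theory Defs
  imports "HOL-Analysis.Analysis"
begin

datatype quat = Quat (QA: real) (QB: real) (QC: real) (QD: real)

lemma quat_eq_iff: "p = q \<longleftrightarrow> QA p = QA q \<and> QB p = QB q \<and> QC p = QC q \<and> QD p = QD q"
  by (auto intro: quat.expand)

instantiation quat :: real_vector
begin

definition "0 = Quat 0 0 0 0"
definition "p + q = Quat (QA p + QA q) (QB p + QB q) (QC p + QC q) (QD p + QD q)"
definition "- p = Quat (- QA p) (- QB p) (- QC p) (- QD p)"
definition "p - q = Quat (QA p - QA q) (QB p - QB q) (QC p - QC q) (QD p - QD q)"
definition "r *\<^sub>R p = Quat (r * QA p) (r * QB p) (r * QC p) (r * QD p)"

instance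
  by standard
    (simp_all add: quat_eq_iff zero_quat_def plus_quat_def uminus_quat_def minus_quat_def
      scaleR_quat_def algebra_simps)

end

lemma quat_vector_sel [simp]:
  "QA 0 = 0" "QB 0 = 0" "QC 0 = 0" "QD 0 = 0"
  "QA (p + q) = QA p + QA q" "QB (p + q) = QB p + QB q"
  "QC (p + q) = QC p + QC q" "QD (p + q) = QD p + QD q"
  "QA (- p) = - QA p" "QB (- p) = - QB p" "QC (- p) = - QC p" "QD (- p) = - QD p"
  "QA (p - q) = QA p - QA q" "QB (p - q) = QB p - QB q"
  "QC (p - q) = QC p - QC q" "QD (p - q) = QD p - QD q"
  "QA (r *\<^sub>R p) = r * QA p" "QB (r *\<^sub>R p) = r * QB p"
  "QC (r *\<^sub>R p) = r * QC p" "QD (r *\<^sub>R p) = r * QD p"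
  by (simp_all add: zero_quat_def plus_quat_def uminus_quat_def minus_quat_def scaleR_quat_def)

instantiation quat :: real_inner
begin

definition inner_quat :: "quat \<Rightarrow> quat \<Rightarrow> real" where
  "inner_quat p q = QA p * QA q + QB p * QB q + QC p * QC q + QD p * QD q"
definition norm_quat :: "quat \<Rightarrow> real" where
  "norm_quat p = sqrt ((QA p)\<^sup>2 + (QB p)\<^sup>2 + (QC p)\<^sup>2 + (QD p)\<^sup>2)"
definition sgn_quat :: "quat \<Rightarrow> quat" where
  "sgn_quat p = p /\<^sub>R norm p"
definition dist_quat :: "quat \<Rightarrow> quat \<Rightarrow> real" where
  "dist_quat p q = norm (p - q)"
definition uniformity_quat :: "(quat \<times> quat) filter" where
  "uniformity_quat = (INF e\<in>{0 <..}. principal {(p, q). dist p q < e})"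
definition open_quat :: "quat set \<Rightarrow> bool" where
  "open_quat U \<longleftrightarrow> (\<forall>p\<in>U. eventually (\<lambda>(p', q). p' = p \<longrightarrow> q \<in> U) uniformity)"

instance
proof
  fix p q r :: quat and a :: real and U :: "quat set"
  show "dist p q = norm (p - q)" by (rule dist_quat_def)
  show "sgn p = p /\<^sub>R norm p" by (rule sgn_quat_def)
  show "uniformity = (INF e\<in>{0 <..}. principal {(p::quat, q). dist p q < e})"
    by (rule uniformity_quat_def)
  show "open U \<longleftrightarrow> (\<forall>p\<in>U. eventually (\<lambda>(p', q). p' = p \<longrightarrow> q \<in> U) uniformity)"
    by (rule open_quat_def)
  show "inner p q = inner q p" by (simp add: inner_quat_def mult.commute)
  show "inner (p + q) r = inner p r + inner q r" by (simp add: inner_quat_def algebra_simps)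
  show "inner (a *\<^sub>R p) q = a * inner p q" by (simp add: inner_quat_def algebra_simps)
  show "0 \<le> inner p p" by (simp add: inner_quat_def)
  show "inner p p = 0 \<longleftrightarrow> p = 0"
    by (simp add: inner_quat_def quat_eq_iff add_nonneg_eq_0_iff)
  show "norm p = sqrt (inner p p)" by (simp add: inner_quat_def norm_quat_def power2_eq_square)
qed

end

instantiation quat :: real_normed_div_algebra
begin

definition "1 = Quat 1 0 0 0"
definition "p * q = Quat
  (QA p * QA q - QB p * QB q - QC p * QC q - QD p * QD q)
  (QA p * QB q + QB p * QA q + QC p * QD q - QD p * QC q)
  (QA p * QC q - QB p * QD q + QC p * QA q + QD p * QB q)
  (QA p * QD q + QB p * QC q - QC p * QB q + QD p * QA q)"
definition "inverse p =
  (let n = (QA p)\<^sup>2 + (QB p)\<^sup>2 + (QC p)\<^sup>2 + (QD p)\<^sup>2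
   in Quat (QA p / n) (- QB p / n) (- QC p / n) (- QD p / n))"
definition divide_quat :: "quat \<Rightarrow> quat \<Rightarrow> quat" where
  "divide_quat p q = p * inverse q"

lemma norm_quat_pos: "p \<noteq> 0 \<Longrightarrow> (QA p)\<^sup>2 + (QB p)\<^sup>2 + (QC p)\<^sup>2 + (QD p)\<^sup>2 > 0" for p :: quat
  by (metis norm_quat_def real_sqrt_gt_0_iff zero_less_norm_iff)

instance
proof
  fix p q r :: quat and a :: real
  show "p * q * r = p * (q * r)"
    by (simp add: quat_eq_iff times_quat_def algebra_simps)
  show "(p + q) * r = p * r + q * r" "p * (q + r) = p * q + p * r"
    by (simp_all add: quat_eq_iff times_quat_def algebra_simps)
  show "1 * p = p" "p * 1 = p" by (simp_all add: quat_eq_iff one_quat_def times_quat_def)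
  show "(0::quat) \<noteq> 1" by (simp add: quat_eq_iff one_quat_def)
  show "a *\<^sub>R p * q = a *\<^sub>R (p * q)" "p * a *\<^sub>R q = a *\<^sub>R (p * q)"
    by (simp_all add: quat_eq_iff times_quat_def algebra_simps)
  show "divide p q = p * inverse q" by (rule divide_quat_def)
  show "inverse (0::quat) = 0" by (simp add: quat_eq_iff inverse_quat_def)
  show "inverse p * p = 1" "p * inverse p = 1" if "p \<noteq> 0"
    using norm_quat_pos[OF that]
    by (simp_all add: quat_eq_iff inverse_quat_def times_quat_def one_quat_def Let_def
        add_divide_distrib[symmetric] diff_divide_distrib[symmetric] power2_eq_square mult.commute)
  show "norm (p * q) = norm p * norm q"
    unfolding norm_quat_def real_sqrt_mult[symmetric]
    by (simp add: times_quat_def power2_eq_square algebra_simps)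
qed

end

definition qi :: quat where "qi = Quat 0 1 0 0"
definition qj :: quat where "qj = Quat 0 0 1 0"
definition qk :: quat where "qk = Quat 0 0 0 1"

definition qcnj :: "quat \<Rightarrow> quat" where
  "qcnj q = Quat (QA q) (- QB q) (- QC q) (- QD q)"

lemma quat_units_rels:
  "qi\<^sup>2 = -1" "qj\<^sup>2 = -1" "qk\<^sup>2 = -1" "qi * qj * qk = -1"
  by (simp_all add: quat_eq_iff qi_def qj_def qk_def times_quat_def one_quat_def power2_eq_square)

lemma quat_expansion:
  "q = of_real (QA q) + qi * of_real (QB q) + qj * of_real (QC q) + qk * of_real (QD q)"
  by (simp add: quat_eq_iff qi_def qj_def qk_def times_quat_def one_quat_def of_real_def)

lemma quat_mult_qcnj: "q * qcnj q = of_real ((norm q)\<^sup>2)"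
  by (simp add: quat_eq_iff qcnj_def times_quat_def one_quat_def of_real_def norm_quat_def
      power2_eq_square)

abbreviation qunits :: "quat set" where
  "qunits \<equiv> {1, qi, qj, qk}"

lemma qunits_distinct: "distinct [1, qi, qj, qk]"
  by (simp add: quat_eq_iff qi_def qj_def qk_def one_quat_def)

definition qrot :: "quat \<Rightarrow> quat \<Rightarrow> quat" where
  "qrot \<mu> p = \<mu> * p * inverse \<mu>"

definition qrot_cnj :: "quat \<Rightarrow> quat \<Rightarrow> quat" where
  "qrot_cnj \<mu> p = qcnj (qrot \<mu> p)"

text \<open>The partial derivatives with respect to \<open>q\<^sub>a, q\<^sub>b, q\<^sub>c, q\<^sub>d\<close> are the derivatives along the
  lines in the directions \<open>1, i, j, k\<close>. Their values are junk where they do not exist;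
  existence of all four is recorded by \<open>qpartials_exist\<close>.\<close>

definition qpartial :: "quat \<Rightarrow> (quat \<Rightarrow> quat) \<Rightarrow> quat \<Rightarrow> quat" where
  "qpartial u f q = vector_derivative (\<lambda>t. f (q + t *\<^sub>R u)) (at 0)"

definition qpartials_exist :: "(quat \<Rightarrow> quat) \<Rightarrow> quat \<Rightarrow> bool" where
  "qpartials_exist f q \<longleftrightarrow> (\<forall>u\<in>qunits. (\<lambda>t::real. f (q + t *\<^sub>R u)) differentiable (at 0))"

text \<open>The left HR derivatives with respect to \<open>q\<^sup>\<mu>\<close> and \<open>q\<^sup>\<mu>\<^sup>*\<close>. The units multiply the partial
  derivatives from the right, and both formulas involve \<open>i\<^sup>\<mu>, j\<^sup>\<mu>, k\<^sup>\<mu>\<close> without conjugation.\<close>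

definition left_HR :: "quat \<Rightarrow> (quat \<Rightarrow> quat) \<Rightarrow> quat \<Rightarrow> quat" where
  "left_HR \<mu> f q = (1/4) *\<^sub>R
     (qpartial 1 f q - qpartial qi f q * qrot \<mu> qi
        - qpartial qj f q * qrot \<mu> qj - qpartial qk f q * qrot \<mu> qk)"

definition left_HR_cnj :: "quat \<Rightarrow> (quat \<Rightarrow> quat) \<Rightarrow> quat \<Rightarrow> quat" where
  "left_HR_cnj \<mu> f q = (1/4) *\<^sub>R
     (qpartial 1 f q + qpartial qi f q * qrot \<mu> qi
        + qpartial qj f q * qrot \<mu> qj + qpartial qk f q * qrot \<mu> qk)"

text \<open>\<open>left_HR_C n S f\<close>: all iterated left HR derivatives of \<open>f\<close> of order at most \<open>n\<close>, in any
  combination of the variables \<open>q\<^sup>\<mu>\<close> and \<open>q\<^sup>\<mu>\<^sup>*\<close>, exist and are continuous on \<open>S\<close> (order 0 being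
  \<open>f\<close> itself). A left HR derivative exists at a point when the four partial derivatives in
  its definition do. Only meaningful for open \<open>S\<close>.\<close>

primrec left_HR_C :: "nat \<Rightarrow> quat set \<Rightarrow> (quat \<Rightarrow> quat) \<Rightarrow> bool" where
  "left_HR_C 0 S f \<longleftrightarrow> continuous_on S f"
| "left_HR_C (Suc n) S f \<longleftrightarrow>
     continuous_on S f \<and> (\<forall>q\<in>S. qpartials_exist f q) \<and>
     (\<forall>\<mu>\<in>qunits. left_HR_C n S (left_HR \<mu> f) \<and> left_HR_C n S (left_HR_cnj \<mu> f))"

end

theory Submission
  imports Defs
begin

text \<open>
  For fixed \<open>\<lambda>\<close>, the family of left HR derivatives encodes the directional derivative
  \<open>D\<^sub>\<lambda> f\<close>, through the identity
    \<open>D\<^sub>\<lambda> f = \<Sum>\<^sub>\<mu> \<partial>f/\<partial>q\<^sup>\<mu> \<cdot> \<lambda>\<^sup>\<mu> = \<Sum>\<^sub>\<mu> \<partial>f/\<partial>q\<^sup>\<mu>\<^sup>* \<cdot> \<lambda>\<^sup>\<mu>\<^sup>*\<close>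
  (\<open>sum_left_HR_qrot\<close>, \<open>sum_left_HR_cnj_qrot_cnj\<close>). It is pure algebra: averaging over the four
  rotations \<open>\<mu>\<close> kills every non-real part, so that multiplying \<open>\<partial>f/\<partial>q\<^sup>\<mu>\<close> by \<open>\<lambda>\<^sup>\<mu>\<close> and summing
  isolates the real coordinates of \<open>\<lambda>\<close>. Because the factor \<open>\<lambda>\<^sup>\<mu>\<close> stands on the right and does not
  depend on the point, applying the identity once more to each \<open>\<partial>f/\<partial>q\<^sup>\<mu>\<close> gives
    \<open>D\<^sub>\<lambda> D\<^sub>\<lambda> f = \<Sum>\<^sub>\<mu>\<^sub>,\<^sub>\<nu> \<partial>\<^sup>2f/\<partial>q\<^sup>\<nu>\<partial>q\<^sup>\<mu> \<cdot> \<lambda>\<^sup>\<nu> \<lambda>\<^sup>\<mu>\<close>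
  in exactly the order of factors that the theorem has, and likewise for third order. The expansion
  is therefore Taylor's formula for \<open>t \<mapsto> f (q\<^sub>0 + t\<lambda>)\<close> on \<open>[0,1]\<close>.

  Two analytic points remain. The hypotheses speak only of partial derivatives; these are
  recovered as right linear combinations of left HR derivatives (\<open>qpartial_eq_sum_left_HR\<close>), hence
  are continuous, and continuous partial derivatives yield a Frechet derivative
  (\<open>has_derivative_of_continuous_qpartials\<close>). The third derivative along the segment has norm at
  most \<open>M |\<lambda>|\<^sup>3\<close>, with \<open>M\<close> a bound near \<open>q\<^sub>0\<close> for the sum of the norms of the third-order left HR
  derivatives. The Taylor step sees the HR derivatives only through the identity above, the
  equality \<open>|\<lambda>\<^sup>\<mu>| = |\<lambda>\<^sup>\<mu>\<^sup>*| = |\<lambda>|\<close> and the fact that each differentiation costs one order of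
  regularity, so \<open>second_order_expansion\<close> treats both families of derivatives at once.
\<close>

section \<open>Continuous directional derivatives and linear approximation\<close>

text \<open>The mean value inequality along one direction, chained over the directions in \<open>U\<close>: the
  increments \<open>h u *\<^sub>R u\<close> are added one at a time, and the hypothesis on the radius keeps the
  polygonal path inside the ball.\<close>

lemma increment_along_directions:
  fixes f :: "'a::real_normed_vector \<Rightarrow> 'b::real_normed_vector"
  assumes "finite U"
    and deriv: "\<And>u y. u \<in> U \<Longrightarrow> y \<in> ball q r \<Longrightarrow>
      ((\<lambda>t. f (y + t *\<^sub>R u)) has_vector_derivative D u y) (at 0)"
    and close: "\<And>u y. u \<in> U \<Longrightarrow> y \<in> ball q r \<Longrightarrow> norm (D u y - L u) \<le> e"
    and small: "norm (x - q) + (\<Sum>u\<in>U. \<bar>h u\<bar> * norm u) < r"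
  shows "norm (f (x + (\<Sum>u\<in>U. h u *\<^sub>R u)) - f x - (\<Sum>u\<in>U. h u *\<^sub>R L u)) \<le> e * (\<Sum>u\<in>U. \<bar>h u\<bar>)"
  using assms
proof (induction U arbitrary: x rule: finite_induct)
  case empty
  then show ?case by simp
next
  case (insert u U)
  define x' where "x' = x + h u *\<^sub>R u"
  have tri: "norm (x + t *\<^sub>R u - q) \<le> norm (x - q) + \<bar>t\<bar> * norm u" for t
    using norm_triangle_ineq[of "x - q" "t *\<^sub>R u"] by (simp add: algebra_simps)
  have small': "norm (x - q) + \<bar>h u\<bar> * norm u + (\<Sum>u\<in>U. \<bar>h u\<bar> * norm u) < r"
    using insert.prems(3) insert.hyps by simp
  have nonneg: "0 \<le> (\<Sum>u\<in>U. \<bar>h u\<bar> * norm u)"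
    by (simp add: sum_nonneg)
  have tail: "norm (f (x' + (\<Sum>u\<in>U. h u *\<^sub>R u)) - f x' - (\<Sum>u\<in>U. h u *\<^sub>R L u))
      \<le> e * (\<Sum>u\<in>U. \<bar>h u\<bar>)"
  proof (rule insert.IH)
    show "norm (x' - q) + (\<Sum>u\<in>U. \<bar>h u\<bar> * norm u) < r"
      using tri[of "h u"] small' unfolding x'_def by linarith
  qed (use insert.prems in auto)
  have "norm (f (x + 1 *\<^sub>R (h u *\<^sub>R u)) - f (x + 0 *\<^sub>R (h u *\<^sub>R u)) - h u *\<^sub>R L u) \<le> e * \<bar>h u\<bar>"
  proof -
    define g where "g t = f (x + t *\<^sub>R (h u *\<^sub>R u)) - t *\<^sub>R (h u *\<^sub>R L u)" for t
    have inball: "x + t *\<^sub>R (h u *\<^sub>R u) \<in> ball q r" if "t \<in> {0..1}" for t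
    proof -
      have "\<bar>t * h u\<bar> * norm u \<le> \<bar>h u\<bar> * norm u"
        using that by (intro mult_right_mono) (auto simp: abs_mult mult_left_le_one_le)
      then show ?thesis
        using tri[of "t * h u"] small' nonneg
        by (simp add: dist_norm norm_minus_commute)
    qed
    have g': "(g has_vector_derivative h u *\<^sub>R (D u (x + t *\<^sub>R (h u *\<^sub>R u)) - L u))
        (at t within {0..1})" if t: "t \<in> {0..1}" for t
    proof -
      let ?y = "x + t *\<^sub>R (h u *\<^sub>R u)"
      have "((\<lambda>s. f (?y + s *\<^sub>R u)) has_vector_derivative D u ?y) (at ((t - t) * h u))"
        using insert.prems(1)[OF _ inball[OF t]] by simp
      moreover have "((\<lambda>s. (s - t) * h u) has_vector_derivative h u) (at t)"
        unfolding has_real_derivative_iff_has_vector_derivative[symmetric]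
        by (auto intro!: derivative_eq_intros)
      ultimately have "((\<lambda>s. f (?y + s *\<^sub>R u)) \<circ> (\<lambda>s. (s - t) * h u)
          has_vector_derivative h u *\<^sub>R D u ?y) (at t)"
        by (intro vector_diff_chain_at)
      then have "((\<lambda>s. f (x + s *\<^sub>R (h u *\<^sub>R u))) has_vector_derivative h u *\<^sub>R D u ?y) (at t)"
        by (simp add: o_def algebra_simps)
      then have "(g has_vector_derivative h u *\<^sub>R D u ?y - h u *\<^sub>R L u) (at t)"
        unfolding g_def
        by (intro has_vector_derivative_diff)
          (auto simp: has_vector_derivative_def intro!: derivative_eq_intros)
      then show ?thesis
        by (simp add: scaleR_diff_right has_vector_derivative_at_within)
    qed
    have "norm (g 1 - g 0) \<le> (\<bar>h u\<bar> * e) * norm (1 - 0 :: real)"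
    proof (rule differentiable_bound[where S = "{0..1}"])
      fix t :: real assume t: "t \<in> {0..1}"
      show "(g has_derivative (\<lambda>s. s *\<^sub>R (h u *\<^sub>R (D u (x + t *\<^sub>R (h u *\<^sub>R u)) - L u))))
          (at t within {0..1})"
        using g'[OF t] by (simp only: has_vector_derivative_def)
      have d: "norm (D u (x + t *\<^sub>R (h u *\<^sub>R u)) - L u) \<le> e"
        using insert.prems(2)[OF _ inball[OF t]] by simp
      show "onorm (\<lambda>s. s *\<^sub>R (h u *\<^sub>R (D u (x + t *\<^sub>R (h u *\<^sub>R u)) - L u))) \<le> \<bar>h u\<bar> * e"
      proof (rule onorm_le)
        fix s :: real
        have "\<bar>s\<bar> * (\<bar>h u\<bar> * norm (D u (x + t *\<^sub>R (h u *\<^sub>R u)) - L u)) \<le> \<bar>s\<bar> * (\<bar>h u\<bar> * e)"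
          by (intro mult_left_mono d abs_ge_zero)
        then show "norm (s *\<^sub>R (h u *\<^sub>R (D u (x + t *\<^sub>R (h u *\<^sub>R u)) - L u)))
            \<le> \<bar>h u\<bar> * e * norm s"
          by (simp add: abs_mult mult_ac)
      qed
    qed auto
    then show ?thesis
      by (simp add: g_def algebra_simps)
  qed
  then have head: "norm (f x' - f x - h u *\<^sub>R L u) \<le> e * \<bar>h u\<bar>"
    by (simp add: x'_def)
  have "f (x + (\<Sum>u\<in>insert u U. h u *\<^sub>R u)) - f x - (\<Sum>u\<in>insert u U. h u *\<^sub>R L u) =
      (f (x' + (\<Sum>u\<in>U. h u *\<^sub>R u)) - f x' - (\<Sum>u\<in>U. h u *\<^sub>R L u)) + (f x' - f x - h u *\<^sub>R L u)"
    using insert.hyps by (simp add: x'_def algebra_simps)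
  also have "norm \<dots> \<le> e * (\<Sum>u\<in>U. \<bar>h u\<bar>) + e * \<bar>h u\<bar>"
    by (rule norm_triangle_le[OF add_mono[OF tail head]])
  finally show ?case
    using insert.hyps by (simp add: algebra_simps)
qed

lemma sum_qunits:
  fixes F :: "quat \<Rightarrow> 'a::comm_monoid_add"
  shows "(\<Sum>\<mu>\<in>qunits. F \<mu>) = F 1 + (F qi + (F qj + F qk))"
  using qunits_distinct by simp

lemma norm_qunits: "u \<in> qunits \<Longrightarrow> norm u = 1"
  by (auto simp: norm_quat_def qi_def qj_def qk_def one_quat_def)

lemma inner_qunits:
  "inner 1 l = QA l" "inner qi l = QB l" "inner qj l = QC l" "inner qk l = QD l"
  by (simp_all add: inner_quat_def qi_def qj_def qk_def one_quat_def)

lemma sum_inner_qunits: "(\<Sum>u\<in>qunits. inner u l *\<^sub>R u) = l"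
  unfolding sum_qunits inner_qunits
  by (simp add: quat_eq_iff qi_def qj_def qk_def one_quat_def)

lemma has_derivative_of_continuous_qpartials:
  fixes f :: "quat \<Rightarrow> quat"
  assumes "open S" "q \<in> S"
    and ex: "\<And>x. x \<in> S \<Longrightarrow> qpartials_exist f x"
    and cont: "\<And>u. u \<in> qunits \<Longrightarrow> continuous_on S (qpartial u f)"
  shows "(f has_derivative (\<lambda>l. \<Sum>u\<in>qunits. inner u l *\<^sub>R qpartial u f q)) (at q)"
  unfolding has_derivative_at_alt
proof (intro conjI allI impI)
  show "bounded_linear (\<lambda>l. \<Sum>u\<in>qunits. inner u l *\<^sub>R qpartial u f q)"
    by (intro bounded_linear_sum bounded_linear_scaleR_const bounded_linear_inner_right)
  fix e :: real assume "e > 0"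
  \<comment> \<open>Each of the four coordinates of an increment is bounded by its norm, whence the factor 4.\<close>
  have "\<forall>\<^sub>F y in nhds q. y \<in> S \<and> (\<forall>u\<in>qunits. dist (qpartial u f y) (qpartial u f q) < e / 4)"
  proof (intro eventually_conj eventually_ball_finite ballI)
    show "\<forall>\<^sub>F y in nhds q. y \<in> S"
      using assms(1,2) by (rule eventually_nhds_in_open)
    fix u :: quat assume "u \<in> qunits"
    then have "isCont (qpartial u f) q"
      using cont assms(1,2) continuous_on_eq_continuous_at by blast
    then have "(qpartial u f \<longlongrightarrow> qpartial u f q) (nhds q)"
      by (simp add: continuous_at tendsto_at_iff_tendsto_nhds)
    then show "\<forall>\<^sub>F y in nhds q. dist (qpartial u f y) (qpartial u f q) < e / 4"
      by (rule tendstoD) (use \<open>e > 0\<close> in simp)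
  qed simp
  then obtain r where "r > 0" and r: "\<And>y. dist y q < r \<Longrightarrow> y \<in> S"
      "\<And>y u. dist y q < r \<Longrightarrow> u \<in> qunits \<Longrightarrow> dist (qpartial u f y) (qpartial u f q) < e / 4"
    unfolding eventually_nhds_metric by blast
  show "\<exists>d>0. \<forall>y. norm (y - q) < d \<longrightarrow>
      norm (f y - f q - (\<Sum>u\<in>qunits. inner u (y - q) *\<^sub>R qpartial u f q)) \<le> e * norm (y - q)"
  proof (intro exI[of _ "r / 4"] conjI allI impI)
    fix y assume y: "norm (y - q) < r / 4"
    have coord: "(\<Sum>u\<in>qunits. \<bar>inner u (y - q)\<bar>) \<le> 4 * norm (y - q)"
    proof -
      have "(\<Sum>u\<in>qunits. \<bar>inner u (y - q)\<bar>) \<le> (\<Sum>u\<in>qunits. norm (y - q))"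
        by (intro sum_mono order_trans[OF Cauchy_Schwarz_ineq2]) (simp add: norm_qunits)
      also have "\<dots> = 4 * norm (y - q)"
        unfolding sum_qunits by simp
      finally show ?thesis .
    qed
    have "norm (f (q + (\<Sum>u\<in>qunits. inner u (y - q) *\<^sub>R u)) - f q
        - (\<Sum>u\<in>qunits. inner u (y - q) *\<^sub>R qpartial u f q))
        \<le> e / 4 * (\<Sum>u\<in>qunits. \<bar>inner u (y - q)\<bar>)"
    proof (rule increment_along_directions[where D = "\<lambda>u. qpartial u f" and q = q and r = r])
      fix u z assume u: "u \<in> qunits" and z: "z \<in> ball q r"
      then have "z \<in> S"
        using r(1) by (simp add: dist_commute)
      from ex[OF this] u show "((\<lambda>t. f (z + t *\<^sub>R u)) has_vector_derivative qpartial u f z) (at 0)"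
        unfolding qpartials_exist_def qpartial_def vector_derivative_works by blast
      show "norm (qpartial u f z - qpartial u f q) \<le> e / 4"
        using r(2)[of z u] u z by (simp add: dist_norm norm_minus_commute less_imp_le)
    next
      have "(\<Sum>u\<in>qunits. \<bar>inner u (y - q)\<bar> * norm u) = (\<Sum>u\<in>qunits. \<bar>inner u (y - q)\<bar>)"
        by (intro sum.cong refl) (simp add: norm_qunits)
      also have "\<dots> < r"
        by (rule le_less_trans[OF coord]) (use y in simp)
      finally show "norm (q - q) + (\<Sum>u\<in>qunits. \<bar>inner u (y - q)\<bar> * norm u) < r"
        by (simp only: diff_self norm_zero add_0_left)
    qed simp
    also have "\<dots> \<le> e / 4 * (4 * norm (y - q))"
      by (rule mult_left_mono[OF coord]) (use \<open>e > 0\<close> in simp)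
    finally show "norm (f y - f q - (\<Sum>u\<in>qunits. inner u (y - q) *\<^sub>R qpartial u f q))
        \<le> e * norm (y - q)"
      by (simp only: sum_inner_qunits add_diff_cancel_left' diff_add_cancel add_diff_eq)
  qed (use \<open>r > 0\<close> in simp)
qed

section \<open>Left HR derivatives and the directional derivative\<close>

lemma qrot_qunits:
  "qrot 1 p = Quat (QA p) (QB p) (QC p) (QD p)"
  "qrot qi p = Quat (QA p) (QB p) (- QC p) (- QD p)"
  "qrot qj p = Quat (QA p) (- QB p) (QC p) (- QD p)"
  "qrot qk p = Quat (QA p) (- QB p) (- QC p) (QD p)"
  by (simp_all add: qrot_def quat_eq_iff inverse_quat_def Let_def times_quat_def
      qi_def qj_def qk_def one_quat_def)

lemma norm_qrot: "\<mu> \<in> qunits \<Longrightarrow> norm (qrot \<mu> l) = norm l"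
  by (simp add: qrot_def norm_mult norm_inverse norm_qunits)

lemma norm_qrot_cnj: "\<mu> \<in> qunits \<Longrightarrow> norm (qrot_cnj \<mu> l) = norm l"
  using norm_qrot[of \<mu> l] by (simp add: qrot_cnj_def norm_quat_def qcnj_def)

text \<open>Since \<open>\<Sum>\<^sub>\<mu> p\<^sup>\<mu> = 4 Re p\<close>, one has \<open>\<Sum>\<^sub>\<mu> \<lambda>\<^sup>\<mu> = 4 \<lambda>\<^sub>a\<close> and
  \<open>\<Sum>\<^sub>\<mu> i\<^sup>\<mu> \<lambda>\<^sup>\<mu> = \<Sum>\<^sub>\<mu> (i\<lambda>)\<^sup>\<mu> = - 4 \<lambda>\<^sub>b\<close>, and similarly for \<open>j\<close> and \<open>k\<close>; the signs in the
  definition of the derivative compensate.\<close>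

lemma sum_left_HR_qrot:
  "(\<Sum>\<mu>\<in>qunits. left_HR \<mu> f x * qrot \<mu> l) = (\<Sum>u\<in>qunits. inner u l *\<^sub>R qpartial u f x)"
  unfolding sum_qunits inner_qunits left_HR_def qrot_qunits
  by (simp add: quat_eq_iff times_quat_def qi_def qj_def qk_def field_simps)

text \<open>Conjugation changes the sign: \<open>\<Sum>\<^sub>\<mu> i\<^sup>\<mu> \<lambda>\<^sup>\<mu>\<^sup>* = \<Sum>\<^sub>\<mu> (i\<lambda>\<^sup>*)\<^sup>\<mu> = 4 \<lambda>\<^sub>b\<close>.\<close>

lemma sum_left_HR_cnj_qrot_cnj:
  "(\<Sum>\<mu>\<in>qunits. left_HR_cnj \<mu> f x * qrot_cnj \<mu> l) = (\<Sum>u\<in>qunits. inner u l *\<^sub>R qpartial u f x)"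
  unfolding sum_qunits inner_qunits left_HR_cnj_def qrot_cnj_def qrot_qunits
  by (simp add: quat_eq_iff times_quat_def qi_def qj_def qk_def qcnj_def field_simps)

lemma qpartial_eq_sum_left_HR:
  assumes "u \<in> qunits"
  shows "qpartial u f x = (\<Sum>\<mu>\<in>qunits. left_HR \<mu> f x * qrot \<mu> u)"
  using assms unfolding sum_left_HR_qrot sum_qunits inner_qunits
  by (auto simp: qi_def qj_def qk_def one_quat_def)

lemma left_HR_C_imp_continuous_on: "left_HR_C n S f \<Longrightarrow> continuous_on S f"
  by (cases n) auto

lemma left_HR_C_imp_has_derivative:
  assumes "open S" "q \<in> S" and C: "left_HR_C (Suc n) S f"
  shows "(f has_derivative (\<lambda>l. \<Sum>u\<in>qunits. inner u l *\<^sub>R qpartial u f q)) (at q)"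
proof (rule has_derivative_of_continuous_qpartials[OF assms(1,2)])
  show "qpartials_exist f x" if "x \<in> S" for x
    using C that by simp
  fix u :: quat assume u: "u \<in> qunits"
  have "continuous_on S (left_HR \<mu> f)" if "\<mu> \<in> qunits" for \<mu>
    using C that left_HR_C_imp_continuous_on by auto
  then have "continuous_on S (\<lambda>x. \<Sum>\<mu>\<in>qunits. left_HR \<mu> f x * qrot \<mu> u)"
    by (intro continuous_on_sum continuous_on_mult continuous_on_const)
  then show "continuous_on S (qpartial u f)"
    unfolding qpartial_eq_sum_left_HR[OF u, abs_def] .
qed

section \<open>Taylor expansion along a segment\<close>

text \<open>Pairing with the remainder itself reduces the vector-valued estimate to the real Taylor
  formula with Lagrange remainder.\<close>

lemma vector_Taylor_bound:
  fixes \<phi> :: "nat \<Rightarrow> real \<Rightarrow> 'a::real_inner"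
  assumes "0 < n"
    and deriv: "\<And>m t. m < n \<Longrightarrow> t \<in> {0..1} \<Longrightarrow> (\<phi> m has_vector_derivative \<phi> (Suc m) t) (at t)"
    and bound: "\<And>t. t \<in> {0..1} \<Longrightarrow> norm (\<phi> n t) \<le> M"
  shows "norm (\<phi> 0 1 - (\<Sum>m<n. (1 / fact m) *\<^sub>R \<phi> m 0)) \<le> M / fact n"
proof -
  define R where "R = \<phi> 0 1 - (\<Sum>m<n. (1 / fact m) *\<^sub>R \<phi> m 0)"
  have D: "((\<lambda>t. inner R (\<phi> m t)) has_real_derivative inner R (\<phi> (Suc m) t)) (at t)"
    if "m < n" "0 \<le> t" "t \<le> 1" for m t
    unfolding has_real_derivative_iff_has_vector_derivative
    by (rule bounded_linear.has_vector_derivative[OF bounded_linear_inner_right])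
      (use deriv that in simp)
  have "\<exists>t>0. t \<le> 1 \<and> inner R (\<phi> 0 1) =
      (\<Sum>m<n. inner R (\<phi> m 0) / fact m * 1 ^ m) + inner R (\<phi> n t) / fact n * 1 ^ n"
    using Maclaurin2[where h = 1 and n = n and diff = "\<lambda>m t. inner R (\<phi> m t)"
        and f = "\<lambda>t. inner R (\<phi> 0 t)"] D by auto
  then obtain t where t: "0 < t" "t \<le> 1"
    and eq: "inner R (\<phi> 0 1) = (\<Sum>m<n. inner R (\<phi> m 0) / fact m) + inner R (\<phi> n t) / fact n"
    by auto
  have "inner R R = inner R (\<phi> n t) / fact n"
  proof -
    have "inner R R = inner R (\<phi> 0 1) - (\<Sum>m<n. inner R (\<phi> m 0) / fact m)"
      by (subst (2) R_def) (simp add: inner_diff_right inner_sum_right)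
    then show ?thesis
      using eq by simp
  qed
  also have "\<dots> \<le> norm R * M / fact n"
    using bound[of t] t
    by (intro divide_right_mono order_trans[OF norm_cauchy_schwarz] mult_left_mono) auto
  finally have "norm R * norm R \<le> norm R * (M / fact n)"
    by (simp add: power2_norm_eq_inner[symmetric] power2_eq_square)
  moreover have "0 \<le> M / fact n"
    using order_trans[OF norm_ge_zero bound[of 0]] by simp
  ultimately have "norm R \<le> M / fact n"
    by (metis mult_le_cancel_left_pos norm_zero zero_less_norm_iff)
  then show ?thesis
    unfolding R_def .
qed

text \<open>Here \<open>D \<mu>\<close> stands for either \<open>\<partial>/\<partial>q\<^sup>\<mu>\<close> or \<open>\<partial>/\<partial>q\<^sup>\<mu>\<^sup>*\<close> and \<open>\<rho> \<mu> l\<close> for the matching \<open>l\<^sup>\<mu>\<close> or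
  \<open>l\<^sup>\<mu>\<^sup>*\<close>. The factors \<open>\<rho> \<mu> l\<close> are constant along the segment and stand to the right of what is
  differentiated, so each further differentiation inserts its own factor just to the left of
  them.\<close>

lemma second_order_expansion:
  fixes D :: "quat \<Rightarrow> (quat \<Rightarrow> quat) \<Rightarrow> quat \<Rightarrow> quat" and \<rho> :: "quat \<Rightarrow> quat \<Rightarrow> quat"
  assumes "open S" "q0 \<in> S" and f: "left_HR_C 3 S f"
    and lower: "\<And>n g \<mu>. left_HR_C (Suc n) S g \<Longrightarrow> \<mu> \<in> qunits \<Longrightarrow> left_HR_C n S (D \<mu> g)"
    and total: "\<And>g x l. (\<Sum>\<mu>\<in>qunits. D \<mu> g x * \<rho> \<mu> l) = (\<Sum>u\<in>qunits. inner u l *\<^sub>R qpartial u g x)"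
    and isometric: "\<And>\<mu> l. \<mu> \<in> qunits \<Longrightarrow> norm (\<rho> \<mu> l) = norm l"
  shows "(\<lambda>l. norm (f (q0 + l) - f q0 -
            ((\<Sum>\<mu>\<in>qunits. D \<mu> f q0 * \<rho> \<mu> l) +
             (1/2) *\<^sub>R (\<Sum>\<mu>\<in>qunits. \<Sum>\<nu>\<in>qunits. D \<nu> (D \<mu> f) q0 * \<rho> \<nu> l * \<rho> \<mu> l))))
           \<in> O[at 0 within A](\<lambda>l. norm l ^ 3)"
proof -
  have f1: "left_HR_C 2 S (D \<mu> f)" if "\<mu> \<in> qunits" for \<mu>
    using lower[of 2 f \<mu>] f that by (simp add: numeral_3_eq_3 numeral_2_eq_2)
  have f2: "left_HR_C 1 S (D \<nu> (D \<mu> f))" if "\<mu> \<in> qunits" "\<nu> \<in> qunits" for \<mu> \<nu>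
    using lower[of 1 "D \<mu> f" \<nu>] f1 that by (simp add: numeral_2_eq_2)
  have f3: "left_HR_C 0 S (D \<kappa> (D \<nu> (D \<mu> f)))"
    if "\<mu> \<in> qunits" "\<nu> \<in> qunits" "\<kappa> \<in> qunits" for \<mu> \<nu> \<kappa>
    using lower[of 0 "D \<nu> (D \<mu> f)" \<kappa>] f2 that by simp
  have line: "((\<lambda>t. g (q0 + t *\<^sub>R l)) has_vector_derivative
      (\<Sum>\<mu>\<in>qunits. D \<mu> g (q0 + t *\<^sub>R l) * \<rho> \<mu> l)) (at t)"
    if "left_HR_C (Suc n) S g" "q0 + t *\<^sub>R l \<in> S" for n g t l
  proof -
    have "((\<lambda>t. q0 + t *\<^sub>R l) has_derivative (\<lambda>s. s *\<^sub>R l)) (at t)"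
      by (auto intro!: derivative_eq_intros)
    from has_derivative_compose[OF this left_HR_C_imp_has_derivative[OF assms(1) that(2,1)]]
    have "((\<lambda>t. g (q0 + t *\<^sub>R l)) has_derivative
        (\<lambda>s. \<Sum>u\<in>qunits. inner u (s *\<^sub>R l) *\<^sub>R qpartial u g (q0 + t *\<^sub>R l))) (at t)" .
    moreover have "(\<lambda>s. \<Sum>u\<in>qunits. inner u (s *\<^sub>R l) *\<^sub>R qpartial u g (q0 + t *\<^sub>R l)) =
        (\<lambda>s. s *\<^sub>R (\<Sum>u\<in>qunits. inner u l *\<^sub>R qpartial u g (q0 + t *\<^sub>R l)))"
      by (simp only: scaleR_sum_right inner_scaleR_right scaleR_scaleR)
    ultimately show ?thesis
      unfolding total has_vector_derivative_def by (simp only:)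
  qed

  define K where
    "K x = (\<Sum>\<mu>\<in>qunits. \<Sum>\<nu>\<in>qunits. \<Sum>\<kappa>\<in>qunits. norm (D \<kappa> (D \<nu> (D \<mu> f)) x))" for x
  define M where "M = K q0 + 1"
  have "continuous_on S K"
    unfolding K_def using f3 by (intro continuous_on_sum continuous_on_norm) auto
  then have "isCont K q0"
    using assms(1,2) continuous_on_eq_continuous_at by blast
  then have "(K \<longlongrightarrow> K q0) (nhds q0)"
    by (simp add: continuous_at tendsto_at_iff_tendsto_nhds)
  then have "\<forall>\<^sub>F x in nhds q0. K x < M"
    by (rule order_tendstoD) (simp add: M_def)
  then have "\<forall>\<^sub>F x in nhds q0. x \<in> S \<and> K x < M"
    by (intro eventually_conj eventually_nhds_in_open assms(1,2))
  then obtain r where "r > 0" and r: "\<And>x. dist x q0 < r \<Longrightarrow> x \<in> S \<and> K x < M"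
    unfolding eventually_nhds_metric by blast

  have main: "norm (f (q0 + l) - f q0 -
      ((\<Sum>\<mu>\<in>qunits. D \<mu> f q0 * \<rho> \<mu> l) +
       (1/2) *\<^sub>R (\<Sum>\<mu>\<in>qunits. \<Sum>\<nu>\<in>qunits. D \<nu> (D \<mu> f) q0 * \<rho> \<nu> l * \<rho> \<mu> l)))
      \<le> M / 6 * norm l ^ 3" if "norm l < r" for l
  proof -
    have near: "q0 + t *\<^sub>R l \<in> S \<and> K (q0 + t *\<^sub>R l) < M" if "t \<in> {0..1}" for t
    proof (rule r)
      have "\<bar>t\<bar> * norm l \<le> norm l"
        using that by (simp add: mult_left_le_one_le)
      then show "dist (q0 + t *\<^sub>R l) q0 < r"
        using \<open>norm l < r\<close> by (simp add: dist_norm)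
    qed
    define \<phi>0 where "\<phi>0 t = f (q0 + t *\<^sub>R l)" for t
    define \<phi>1 where "\<phi>1 t = (\<Sum>\<mu>\<in>qunits. D \<mu> f (q0 + t *\<^sub>R l) * \<rho> \<mu> l)" for t
    define \<phi>2 where "\<phi>2 t = (\<Sum>\<mu>\<in>qunits. \<Sum>\<nu>\<in>qunits.
      D \<nu> (D \<mu> f) (q0 + t *\<^sub>R l) * \<rho> \<nu> l * \<rho> \<mu> l)" for t
    define \<phi>3 where "\<phi>3 t = (\<Sum>\<mu>\<in>qunits. \<Sum>\<nu>\<in>qunits. \<Sum>\<kappa>\<in>qunits.
      D \<kappa> (D \<nu> (D \<mu> f)) (q0 + t *\<^sub>R l) * \<rho> \<kappa> l * \<rho> \<nu> l * \<rho> \<mu> l)" for t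
    define \<phi> where "\<phi> m = [\<phi>0, \<phi>1, \<phi>2, \<phi>3] ! m" for m
    have d0: "(\<phi>0 has_vector_derivative \<phi>1 t) (at t)" if "t \<in> {0..1}" for t
      unfolding \<phi>0_def \<phi>1_def using line[of 2 f] f near[OF that]
      by (simp only: numeral_3_eq_3 numeral_2_eq_2)
    have d1: "(\<phi>1 has_vector_derivative \<phi>2 t) (at t)" if "t \<in> {0..1}" for t
      unfolding \<phi>1_def \<phi>2_def sum_distrib_right[symmetric]
    proof (intro has_vector_derivative_sum has_vector_derivative_mult_left)
      fix \<mu> assume "\<mu> \<in> qunits"
      then show "((\<lambda>t. D \<mu> f (q0 + t *\<^sub>R l)) has_vector_derivative
          (\<Sum>\<nu>\<in>qunits. D \<nu> (D \<mu> f) (q0 + t *\<^sub>R l) * \<rho> \<nu> l)) (at t)"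
        using line[of 1 "D \<mu> f"] f1 near[OF that] by (simp only: numeral_2_eq_2 One_nat_def)
    qed
    have d2: "(\<phi>2 has_vector_derivative \<phi>3 t) (at t)" if "t \<in> {0..1}" for t
      unfolding \<phi>2_def \<phi>3_def sum_distrib_right[symmetric]
    proof (intro has_vector_derivative_sum has_vector_derivative_mult_left)
      fix \<mu> \<nu> assume "\<mu> \<in> qunits" "\<nu> \<in> qunits"
      then show "((\<lambda>t. D \<nu> (D \<mu> f) (q0 + t *\<^sub>R l)) has_vector_derivative
          (\<Sum>\<kappa>\<in>qunits. D \<kappa> (D \<nu> (D \<mu> f)) (q0 + t *\<^sub>R l) * \<rho> \<kappa> l)) (at t)"
        using line[of 0 "D \<nu> (D \<mu> f)"] f2 near[OF that] by (simp only: One_nat_def)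
    qed
    have "norm (\<phi> 0 1 - (\<Sum>m<3. (1 / fact m) *\<^sub>R \<phi> m 0)) \<le> (M * norm l ^ 3) / fact 3"
    proof (rule vector_Taylor_bound)
      show "(\<phi> m has_vector_derivative \<phi> (Suc m) t) (at t)" if "m < 3" "t \<in> {0..1}" for m t
      proof -
        have "m = 0 \<or> m = 1 \<or> m = 2"
          using that(1) by auto
        then show ?thesis
          using d0 d1 d2 that(2) unfolding \<phi>_def by (auto simp: numeral_2_eq_2)
      qed
      fix t :: real assume t: "t \<in> {0..1}"
      have "norm (\<phi>3 t) \<le> (\<Sum>\<mu>\<in>qunits. \<Sum>\<nu>\<in>qunits. \<Sum>\<kappa>\<in>qunits.
          norm (D \<kappa> (D \<nu> (D \<mu> f)) (q0 + t *\<^sub>R l)) * norm l ^ 3)"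
        unfolding \<phi>3_def
        by (intro sum_norm_le) (simp add: norm_mult isometric power3_eq_cube mult.assoc)
      also have "\<dots> = K (q0 + t *\<^sub>R l) * norm l ^ 3"
        unfolding K_def sum_distrib_right ..
      also have "\<dots> \<le> M * norm l ^ 3"
        using near[OF t] by (intro mult_right_mono) auto
      finally show "norm (\<phi> 3 t) \<le> M * norm l ^ 3"
        by (simp add: \<phi>_def)
    qed simp
    moreover have "\<phi> 0 1 - (\<Sum>m<3. (1 / fact m) *\<^sub>R \<phi> m 0) = \<phi>0 1 - \<phi>0 0 - (\<phi>1 0 + (1/2) *\<^sub>R \<phi>2 0)"
      by (simp add: \<phi>_def numeral_3_eq_3 algebra_simps)
    ultimately show ?thesis
      unfolding \<phi>0_def \<phi>1_def \<phi>2_def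
      by (simp only: scaleR_one scaleR_zero_left add_0_right) (simp add: fact_numeral)
  qed
  show ?thesis
  proof (rule bigoI[where c = "M / 6"])
    have "\<forall>\<^sub>F l in at 0 within A. norm l < r"
      unfolding eventually_at using \<open>r > 0\<close> by (auto simp: dist_norm)
    then show "\<forall>\<^sub>F l in at 0 within A. norm (norm (f (q0 + l) - f q0 -
        ((\<Sum>\<mu>\<in>qunits. D \<mu> f q0 * \<rho> \<mu> l) +
         (1/2) *\<^sub>R (\<Sum>\<mu>\<in>qunits. \<Sum>\<nu>\<in>qunits. D \<nu> (D \<mu> f) q0 * \<rho> \<nu> l * \<rho> \<mu> l))))
        \<le> M / 6 * norm (norm l ^ 3)"
    proof eventually_elim
      case (elim l)
      show ?case
        unfolding real_norm_def abs_norm_cancel power_abs using main[OF elim] .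
    qed
  qed
qed

section \<open>The second order expansions\<close>

theorem theorem3p20:
  fixes S :: "quat set" and f :: "quat \<Rightarrow> quat" and q0 :: quat
  assumes "open S"
    and "continuous_on S f"
    and "left_HR_C 3 S f"
    and "q0 \<in> S"
  shows "(\<lambda>l. norm (f (q0 + l) - f q0 -
            ((\<Sum>\<mu>\<in>qunits. left_HR \<mu> f q0 * qrot \<mu> l) +
             (1/2) *\<^sub>R (\<Sum>\<mu>\<in>qunits. \<Sum>\<nu>\<in>qunits.
                left_HR \<nu> (left_HR \<mu> f) q0 * qrot \<nu> l * qrot \<mu> l))))
           \<in> O[at 0 within {l. q0 + l \<in> S \<and> closed_segment q0 (q0 + l) \<subseteq> S}](\<lambda>l. norm l ^ 3)
         \<and> (\<lambda>l. norm (f (q0 + l) - f q0 -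
            ((\<Sum>\<mu>\<in>qunits. left_HR_cnj \<mu> f q0 * qrot_cnj \<mu> l) +
             (1/2) *\<^sub>R (\<Sum>\<mu>\<in>qunits. \<Sum>\<nu>\<in>qunits.
                left_HR_cnj \<nu> (left_HR_cnj \<mu> f) q0 * qrot_cnj \<nu> l * qrot_cnj \<mu> l))))
           \<in> O[at 0 within {l. q0 + l \<in> S \<and> closed_segment q0 (q0 + l) \<subseteq> S}](\<lambda>l. norm l ^ 3)"
proof
  show "(\<lambda>l. norm (f (q0 + l) - f q0 -
            ((\<Sum>\<mu>\<in>qunits. left_HR \<mu> f q0 * qrot \<mu> l) +
             (1/2) *\<^sub>R (\<Sum>\<mu>\<in>qunits. \<Sum>\<nu>\<in>qunits.
                left_HR \<nu> (left_HR \<mu> f) q0 * qrot \<nu> l * qrot \<mu> l))))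
           \<in> O[at 0 within {l. q0 + l \<in> S \<and> closed_segment q0 (q0 + l) \<subseteq> S}](\<lambda>l. norm l ^ 3)"
    by (rule second_order_expansion[OF assms(1,4,3) _ sum_left_HR_qrot norm_qrot]) auto
  show "(\<lambda>l. norm (f (q0 + l) - f q0 -
            ((\<Sum>\<mu>\<in>qunits. left_HR_cnj \<mu> f q0 * qrot_cnj \<mu> l) +
             (1/2) *\<^sub>R (\<Sum>\<mu>\<in>qunits. \<Sum>\<nu>\<in>qunits.
                left_HR_cnj \<nu> (left_HR_cnj \<mu> f) q0 * qrot_cnj \<nu> l * qrot_cnj \<mu> l))))
           \<in> O[at 0 within {l. q0 + l \<in> S \<and> closed_segment q0 (q0 + l) \<subseteq> S}](\<lambda>l. norm l ^ 3)"
    by (rule second_order_expansion[OF assms(1,4,3) _ sum_left_HR_cnj_qrot_cnj norm_qrot_cnj]) auto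
qed

end
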